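(* Let $R$ be a commutative ring with $1\neq 0$ and let $\tau$ be a symmetric relation on $R^{\#}$ with $\tau$ refinable. Then the following are equivalent. (1) $R$ is a $\tau$-$r$-FFR. (2) $R$ is a $\tau$-$r$-WFFR. (3) $R$ is a $\tau$-$r$-atomic $\tau$-$r$-idf ring. (4) $R$ is $\tau$-$r$-atomic and each $a\in\mathrm{Reg}(R)^{\#}$ has only finitely many $\tau$-$r$-atomic $\tau$-factorizations up to order and associates. (5) For all $a\in\mathrm{Reg}(R)^{\#}$, there are only finitely many $b\in\mathrm{Reg}(R)^{\#}$ up to associates such that $b$ occurs as a $\tau$-factor in a $\tau$-$r$-factorization of $a$. (6) For all $a\in\mathrm{Reg}(R)^{\#}$, $(a)$ is contained in only finitely many principal ideals $(b)$ where $b\in\mathrm{Reg}(R)^{\#}$ is such that $b$ occurs as a $\tau$-factor in a $\tau$-$r$-factorization of $a$. (7) For all $a\in\mathrm{Reg}(R)^{\#}$, there are only finitely many $b\in\mathrm{Reg}(R)^{\#}$ up to associates such that $b\mid_\tau a$. (8) For all $a\in\mathrm{Reg}(R)^{\#}$, $(a)$ is contained in only finitely many principal ideals $(b)$ where $b\in\mathrm{Reg}(R)^{\#}$ is such that $b\mid_\tau a$.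
   Context: $U(R)$ is the group of units of $R$, $R^{\#}$ the set of nonzero non-units, $\mathrm{Reg}(R)$ the set of regular elements (non-zero-divisors), and $\mathrm{Reg}(R)^{\#}$ the set of regular non-units. Elements $a,b$ are associates, $a\sim b$, if $(a)=(b)$. A $\tau$-factorization of a non-unit $a\in R$ is an expression $a=\lambda a_1\cdots a_n$ with $n\ge 1$, $\lambda\in U(R)$, each $a_i$ a non-unit, and $a_i\,\tau\,a_j$ for all $i\neq j$; it is trivial if $n=1$. The $a_i$ are the $\tau$-factors, or $\tau$-divisors, and $b\mid_\tau a$ means that $b$ occurs as a $\tau$-factor in some $\tau$-factorization of $a$. A $\tau$-$r$-factorization ($\tau$-regular-factorization) is a $\tau$-factorization of an element $a\in\mathrm{Reg}(R)$. A $\tau$-refinement of a $\tau$-factorization $\lambda a_1\cdots a_n$ is a factorization of the form $(\lambda\lambda_1\cdots\lambda_n)b_{11}\cdots b_{1m_1}\cdots b_{n1}\cdots b_{nm_n}$ where $a_i=\lambda_i b_{i1}\cdots b_{im_i}$ is a $\tau$-factorization for each $i$; $\tau$ is refinable if every $\tau$-refinement of a $\tau$-factorization is a $\tau$-factorization. A regular non-unit $a$ is $\tau$-$r$-irreducible (a $\tau$-$r$-atom) if for every $\tau$-$r$-factorization $a=\lambda a_1\cdots a_n$ one has $a\sim a_i$ for some $i$ (equivalently, $a$ has only trivial $\tau$-$r$-factorizations). A $\tau$-$r$-atomic $\tau$-factorization is one whose $\tau$-factors are all $\tau$-$r$-irreducible. $R$ is $\tau$-$r$-atomic if every $a\in\mathrm{Reg}(R)^{\#}$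 has a $\tau$-$r$-factorization into $\tau$-$r$-irreducible elements. $R$ is a $\tau$-$r$-idf ring if each $a\in\mathrm{Reg}(R)^{\#}$ has at most finitely many non-associate $\tau$-$r$-irreducible $\tau$-divisors. $R$ is a $\tau$-$r$-FFR if every $a\in\mathrm{Reg}(R)^{\#}$ has only finitely many $\tau$-factorizations up to order and associates. $R$ is a $\tau$-$r$-WFFR if every $a\in\mathrm{Reg}(R)^{\#}$ has only finitely many non-associate $\tau$-divisors. Two factorizations are the same up to order and associates if they have the same length and their factors can be reordered so that corresponding factors are associates. *)

theory Defs
  imports "HOL-Library.Multiset"
begin

text \<open>The ring is the whole type \<open>'a :: comm_ring_1\<close>; units are the elements \<open>u\<close> with \<open>u dvd 1\<close>.\<close>

definition nonzero_nonunits :: "'a::comm_ring_1 set" where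
  "nonzero_nonunits = {a. a \<noteq> 0 \<and> \<not> a dvd 1}"

definition regular_elements :: "'a::comm_ring_1 set" where
  "regular_elements = {a. \<forall>x. a * x = 0 \<longrightarrow> x = 0}"

definition regular_nonunits :: "'a::comm_ring_1 set" where
  "regular_nonunits = {a \<in> regular_elements. \<not> a dvd 1}"

definition principal_ideal :: "'a::comm_ring_1 \<Rightarrow> 'a set" where
  "principal_ideal a = range (\<lambda>r. r * a)"

definition associate_rel :: "'a::comm_ring_1 rel" where
  "associate_rel = {(a, b). principal_ideal a = principal_ideal b}"

definition finite_up_to_associates :: "'a::comm_ring_1 set \<Rightarrow> bool" where
  "finite_up_to_associates S \<longleftrightarrow> finite (S // associate_rel)"

text \<open>
  A factorization \<open>\<lambda> a\<^sub>1 \<cdots> a\<^sub>n\<close> is encoded by the unit \<open>l\<close> and the list \<open>as\<close> of its factors.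
\<close>

definition tau_factorization :: "'a::comm_ring_1 rel \<Rightarrow> 'a \<Rightarrow> 'a \<Rightarrow> 'a list \<Rightarrow> bool" where
  "tau_factorization \<tau> a l as \<longleftrightarrow>
     \<not> a dvd 1 \<and> l dvd 1 \<and> as \<noteq> [] \<and> (\<forall>x\<in>set as. \<not> x dvd 1) \<and>
     (\<forall>i<length as. \<forall>j<length as. i \<noteq> j \<longrightarrow> (as ! i, as ! j) \<in> \<tau>) \<and>
     a = l * prod_list as"

definition tau_r_factorization :: "'a::comm_ring_1 rel \<Rightarrow> 'a \<Rightarrow> 'a \<Rightarrow> 'a list \<Rightarrow> bool" where
  "tau_r_factorization \<tau> a l as \<longleftrightarrow> a \<in> regular_elements \<and> tau_factorization \<tau> a l as"

definition tau_dvd :: "'a::comm_ring_1 rel \<Rightarrow> 'a \<Rightarrow> 'a \<Rightarrow> bool" where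
  "tau_dvd \<tau> b a \<longleftrightarrow> (\<exists>l as. tau_factorization \<tau> a l as \<and> b \<in> set as)"

definition tau_refinement ::
    "'a::comm_ring_1 rel \<Rightarrow> 'a \<Rightarrow> 'a list \<Rightarrow> 'a \<Rightarrow> 'a list \<Rightarrow> bool" where
  "tau_refinement \<tau> l as l' bs \<longleftrightarrow>
     (\<exists>ls bss. length ls = length as \<and> length bss = length as \<and>
        (\<forall>i<length as. tau_factorization \<tau> (as ! i) (ls ! i) (bss ! i)) \<and>
        l' = l * prod_list ls \<and> bs = concat bss)"

definition refinable :: "'a::comm_ring_1 rel \<Rightarrow> bool" where
  "refinable \<tau> \<longleftrightarrow>
     (\<forall>a l as l' bs. tau_factorization \<tau> a l as \<longrightarrow> tau_refinement \<tau> l as l' bs \<longrightarrow>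
        tau_factorization \<tau> a l' bs)"

definition tau_r_irreducible :: "'a::comm_ring_1 rel \<Rightarrow> 'a \<Rightarrow> bool" where
  "tau_r_irreducible \<tau> a \<longleftrightarrow>
     a \<in> regular_nonunits \<and>
     (\<forall>l as. tau_r_factorization \<tau> a l as \<longrightarrow> (\<exists>x\<in>set as. (a, x) \<in> associate_rel))"

text \<open>Equality of factorizations up to order and associates; the units in front are disregarded.\<close>

definition same_factorization_rel :: "('a::comm_ring_1 \<times> 'a list) rel" where
  "same_factorization_rel =
     {((l, as), (l', bs)). \<exists>cs. mset cs = mset bs \<and>
        list_all2 (\<lambda>x y. (x, y) \<in> associate_rel) as cs}"

definition finite_up_to_order_and_associates :: "('a::comm_ring_1 \<times> 'a list) set \<Rightarrow> bool" where
  "finite_up_to_order_and_associates F \<longleftrightarrow> finite (F // same_factorization_rel)"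

definition tau_r_atomic :: "'a::comm_ring_1 rel \<Rightarrow> bool" where
  "tau_r_atomic \<tau> \<longleftrightarrow>
     (\<forall>a\<in>regular_nonunits.
        \<exists>l as. tau_r_factorization \<tau> a l as \<and> (\<forall>x\<in>set as. tau_r_irreducible \<tau> x))"

definition tau_r_idf :: "'a::comm_ring_1 rel \<Rightarrow> bool" where
  "tau_r_idf \<tau> \<longleftrightarrow>
     (\<forall>a\<in>regular_nonunits. finite_up_to_associates {b. tau_r_irreducible \<tau> b \<and> tau_dvd \<tau> b a})"

definition tau_r_FFR :: "'a::comm_ring_1 rel \<Rightarrow> bool" where
  "tau_r_FFR \<tau> \<longleftrightarrow>
     (\<forall>a\<in>regular_nonunits.
        finite_up_to_order_and_associates {(l, as). tau_factorization \<tau> a l as})"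

definition tau_r_WFFR :: "'a::comm_ring_1 rel \<Rightarrow> bool" where
  "tau_r_WFFR \<tau> \<longleftrightarrow> (\<forall>a\<in>regular_nonunits. finite_up_to_associates {b. tau_dvd \<tau> b a})"

lemma equiv_associate_rel: "equiv UNIV associate_rel"
  by (auto simp: associate_rel_def intro!: equivI refl_onI symI transI)

lemma equiv_same_factorization_rel: "equiv UNIV (same_factorization_rel :: ('a::comm_ring_1 \<times> 'a list) rel)"
proof -
  let ?R = "\<lambda>x y :: 'a. (x, y) \<in> associate_rel"
  have *: "(f, g) \<in> same_factorization_rel \<longleftrightarrow> rel_mset ?R (mset (snd f)) (mset (snd g))" for f g
  proof
    assume "(f, g) \<in> same_factorization_rel"
    then obtain cs where "mset cs = mset (snd g)" "list_all2 ?R (snd f) cs"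
      by (cases f; cases g) (auto simp: same_factorization_rel_def)
    then show "rel_mset ?R (mset (snd f)) (mset (snd g))"
      unfolding rel_mset_def by blast
  next
    assume "rel_mset ?R (mset (snd f)) (mset (snd g))"
    then obtain xs ys where "mset xs = mset (snd f)" "mset ys = mset (snd g)" "list_all2 ?R xs ys"
      by (auto simp: rel_mset_def)
    moreover from this obtain cs where "list_all2 ?R (snd f) cs" "mset cs = mset ys"
      by (metis list_all2_reorder_left_invariance)
    ultimately show "(f, g) \<in> same_factorization_rel"
      by (cases f; cases g) (auto simp: same_factorization_rel_def)
  qed
  have E: "reflp ?R" "symp ?R" "transp ?R"
    using equiv_associate_rel by (auto simp: equiv_def refl_on_def reflp_def symp_def transp_def
        dest: symD transD)
  have "reflp (rel_mset ?R)" "symp (rel_mset ?R)" "transp (rel_mset ?R)"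
    using multiset.rel_reflp[OF E(1)] multiset.rel_symp[OF E(2)] multiset.rel_transp[OF E(3)] by blast+
  then show ?thesis
    by (intro equivI refl_onI symI transI) (auto simp only: * intro: reflpD sympD transpD)
qed

end

theory Submission
  imports Defs
begin

text \<open>
  Write the type of a factorization for the multiset of the principal ideals generated by its
  factors. Being associate means generating the same principal ideal, and being equal up to order
  and associates means having the same type, so that every finiteness condition of the theorem says
  that a set of principal ideals or a set of types is finite. As every factor of a regular element
  is regular, the last four conditions then only rephrase the finiteness of the set of
  \<open>\<tau>\<close>-divisors up to associates.

  Two arguments carry the proof. The first is a cancellation argument: the type of a factorization
  of a regular element cannot be contained properly in the type of another factorization of that
  element, because the surplus factors would multiply to a unit. By Dickson's lemma, the
  factorizations of a regular element that use only finitely many factors up to associates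
  therefore have only finitely many types (\<open>finite_types_if_finite_factors\<close>). This leads from
  finitely many \<open>\<tau>\<close>-divisors to finitely many \<open>\<tau>\<close>-factorizations, and from finitely many
  irreducible \<open>\<tau>\<close>-divisors to finitely many atomic \<open>\<tau>\<close>-factorizations.

  The second is refinement. If the types of the \<open>\<tau>\<close>-factorizations of a regular non-unit are
  finite in number, then some \<open>\<tau>\<close>-factorization is longest; it must be atomic, since a reducible
  factor could be refined into several ones (\<open>tau_r_atomic_if_tau_r_FFR\<close>). Conversely, in an
  atomic ring each \<open>\<tau>\<close>-factorization containing \<open>b\<close> refines to an atomic one in which the factors
  of \<open>b\<close> form a part. So the ideal of a \<open>\<tau>\<close>-divisor is determined by a sub-multiset of the
  type of some atomic \<open>\<tau>\<close>-factorization, and finitely many such types leave only finitely many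
  divisors (\<open>tau_r_WFFR_if_finite_atomic_types\<close>).
\<close>

section \<open>Finiteness of sets of multisets\<close>

lemma finite_image_if_factors:
  assumes "finite (g ` S)" and "\<And>x y. x \<in> S \<Longrightarrow> y \<in> S \<Longrightarrow> g x = g y \<Longrightarrow> h x = h y"
  shows "finite (h ` S)"
proof (rule finite_subset)
  show "h ` S \<subseteq> (h \<circ> inv_into S g) ` g ` S"
  proof
    fix z assume "z \<in> h ` S"
    then obtain x where x: "x \<in> S" "z = h x" by blast
    then have "h x = h (inv_into S g (g x))"
      by (intro assms(2)) (auto simp: f_inv_into_f inv_into_into)
    with x show "z \<in> (h \<circ> inv_into S g) ` g ` S" by auto
  qed
qed (use assms(1) in blast)

lemma finite_submultisets: "finite {K. K \<subseteq># M}"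
proof (induction M)
  case empty
  then show ?case by simp
next
  case (add x M)
  have "K \<in> {K. K \<subseteq># M} \<union> add_mset x ` {K. K \<subseteq># M}" if K: "K \<subseteq># add_mset x M" for K
  proof (cases "x \<in># K")
    case True
    then obtain K' where "K = add_mset x K'" by (meson multi_member_split)
    with K show ?thesis by auto
  next
    case False
    with K show ?thesis
      by (metis (no_types, lifting) UnI1 diff_single_trivial mem_Collect_eq subset_eq_diff_conv add_mset_add_single)
  qed
  then have "{K. K \<subseteq># add_mset x M} \<subseteq> {K. K \<subseteq># M} \<union> add_mset x ` {K. K \<subseteq># M}"
    by blast
  then show ?case
    using add.IH by (meson finite_UnI finite_imageI finite_subset)
qed

text \<open>
  This is Dickson's lemma. Fix a member \<open>N\<close> of the antichain. Every other member has some
  multiplicity below the one in \<open>N\<close>, so the antichain splits into \<open>N\<close> and finitely many classes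
  on which one multiplicity is constant. Deleting the element with constant multiplicity gives an
  antichain over a smaller set.
\<close>

lemma finite_multiset_antichain:
  assumes "finite X" and "\<And>M. M \<in> A \<Longrightarrow> set_mset M \<subseteq> X"
    and "\<And>M N. M \<in> A \<Longrightarrow> N \<in> A \<Longrightarrow> M \<subseteq># N \<Longrightarrow> M = N"
  shows "finite A"
  using assms
proof (induction "card X" arbitrary: X A)
  case 0
  then have "A \<subseteq> {{#}}" by auto
  then show ?case by (rule finite_subset) simp
next
  case (Suc n)
  show ?case
  proof (cases "A = {}")
    case False
    then obtain N where N: "N \<in> A" by blast
    let ?S = "\<lambda>x i. {M \<in> A. count M x = i}"
    have slice: "finite (?S x i)" if x: "x \<in> X" for x i
    proof -
      let ?del = "filter_mset (\<lambda>y. y \<noteq> x)"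
      have restore: "M \<subseteq># N" if "M \<in> ?S x i" "N \<in> ?S x i" "?del M \<subseteq># ?del N" for M N
      proof (rule mset_subset_eqI)
        fix y
        show "count M y \<le> count N y"
          using that mset_subset_eq_count[OF that(3), of y] by (cases "y = x") auto
      qed
      have "finite (?del ` ?S x i)"
      proof (rule Suc.hyps(1))
        show "n = card (X - {x})" using Suc.hyps(2) x Suc.prems(1) by simp
        show "finite (X - {x})" using Suc.prems(1) by simp
        show "set_mset M \<subseteq> X - {x}" if "M \<in> ?del ` ?S x i" for M
          using that by (fastforce dest: Suc.prems(2))
        show "M = M'" if "M \<in> ?del ` ?S x i" "M' \<in> ?del ` ?S x i" "M \<subseteq># M'" for M M'
          using that restore Suc.prems(3) by (smt (verit) imageE mem_Collect_eq)
      qed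
      moreover have "inj_on ?del (?S x i)"
        using restore by (intro inj_onI) (metis (no_types, lifting) subset_mset.antisym subset_mset.order_refl)
      ultimately show ?thesis by (rule finite_imageD)
    qed
    have "M \<in> {N} \<union> (\<Union>x\<in>X. \<Union>i<count N x. ?S x i)" if M: "M \<in> A" for M
    proof (cases "N \<subseteq># M")
      case True
      then show ?thesis using Suc.prems(3) N M by blast
    next
      case False
      then obtain x where x: "count M x < count N x"
        by (meson mset_subset_eqI not_le)
      then have "x \<in># N" by (intro count_inI) simp
      then have "x \<in> X" using Suc.prems(2) N by blast
      with x M show ?thesis by blast
    qed
    then have "A \<subseteq> {N} \<union> (\<Union>x\<in>X. \<Union>i<count N x. ?S x i)" by blast
    moreover have "finite ({N} \<union> (\<Union>x\<in>X. \<Union>i<count N x. ?S x i))"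
      using slice Suc.prems(1) by blast
    ultimately show ?thesis by (rule finite_subset)
  qed simp
qed

section \<open>Principal ideals and types of factorizations\<close>

lemma principal_ideal_subset_iff: "principal_ideal a \<subseteq> principal_ideal b \<longleftrightarrow> b dvd a"
proof
  assume "principal_ideal a \<subseteq> principal_ideal b"
  moreover have "a \<in> principal_ideal a"
    unfolding principal_ideal_def by (rule range_eqI[of _ _ 1]) simp
  ultimately show "b dvd a"
    by (auto simp: principal_ideal_def)
next
  assume "b dvd a"
  then obtain c where "a = b * c" ..
  then have "r * a = (r * c) * b" for r by (simp add: ac_simps)
  then show "principal_ideal a \<subseteq> principal_ideal b"
    unfolding principal_ideal_def by blast
qed

lemma principal_ideal_eq_iff: "principal_ideal a = principal_ideal b \<longleftrightarrow> a dvd b \<and> b dvd a"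
  unfolding set_eq_subset principal_ideal_subset_iff by blast

lemma principal_ideal_unit_mult:
  assumes "l dvd 1" shows "principal_ideal (l * a) = principal_ideal a"
  using mult_dvd_mono[OF assms dvd_refl, of a] by (simp add: principal_ideal_eq_iff)

abbreviation ftype :: "'a::comm_ring_1 list \<Rightarrow> 'a set multiset" where
  "ftype as \<equiv> image_mset principal_ideal (mset as)"

text \<open>
  The type of a factorization determines the principal ideal of its product. This lets finiteness
  of a set of types bound a set of divisors.
\<close>

lemma principal_ideal_prod_mset_cong:
  "image_mset principal_ideal M = image_mset principal_ideal N \<Longrightarrow>
    principal_ideal (prod_mset M) = principal_ideal (prod_mset N)"
proof (induction M arbitrary: N)
  case (add x M)
  obtain y N' where N: "N = add_mset y N'" and "principal_ideal x = principal_ideal y"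
    and "image_mset principal_ideal M = image_mset principal_ideal N'"
    using msed_map_invR[of principal_ideal N] add.prems by (metis image_mset_add_mset)
  with add.IH show ?case
    by (auto simp: principal_ideal_eq_iff intro: mult_dvd_mono)
qed simp

lemma finite_up_to_associates_iff:
  "finite_up_to_associates S \<longleftrightarrow> finite (principal_ideal ` S)"
proof -
  have "(associate_rel :: 'a rel) = kernel principal_ideal"
    by (auto simp: associate_rel_def kernel_def)
  then show ?thesis
    unfolding finite_up_to_associates_def
    by (simp add: bij_betw_finite[OF bij_betw_image_quotient_kernel])
qed

text \<open>
  Matching the factors in some order by associates is the same as having equal multisets of ideals:
  an equality of multisets can always be realized by reordering one of the lists.
\<close>

lemma same_factorization_rel_eq_kernel:
  "same_factorization_rel = kernel (\<lambda>(l, as). ftype as)"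
proof -
  have "(\<exists>cs. mset cs = mset bs \<and> list_all2 (\<lambda>x y. (x, y) \<in> associate_rel) as cs) \<longleftrightarrow>
      ftype as = ftype bs" for as bs :: "'a list"
  proof
    assume "\<exists>cs. mset cs = mset bs \<and> list_all2 (\<lambda>x y. (x, y) \<in> associate_rel) as cs"
    then obtain cs where cs: "mset cs = mset bs"
      and "list_all2 (\<lambda>x y. principal_ideal x = principal_ideal y) as cs"
      by (auto simp: associate_rel_def)
    then have "map principal_ideal as = map principal_ideal cs"
      by (simp add: list_all2_conv_all_nth list_eq_iff_nth_eq)
    with cs show "ftype as = ftype bs" by (metis mset_map)
  next
    assume "ftype as = ftype bs"
    then have "mset (map principal_ideal as) = mset (map principal_ideal bs)" by simp
    moreover have "list_all2 (\<lambda>I y. I = principal_ideal y) (map principal_ideal bs) bs"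
      by (simp add: list_all2_conv_all_nth)
    ultimately obtain cs where "list_all2 (\<lambda>I y. I = principal_ideal y) (map principal_ideal as) cs"
      and "mset cs = mset bs"
      using list_all2_reorder_left_invariance by blast
    then show "\<exists>cs. mset cs = mset bs \<and> list_all2 (\<lambda>x y. (x, y) \<in> associate_rel) as cs"
      by (auto simp: associate_rel_def list_all2_conv_all_nth)
  qed
  then show ?thesis
    by (auto simp: same_factorization_rel_def kernel_def)
qed

lemma finite_up_to_order_and_associates_iff:
  "finite_up_to_order_and_associates F \<longleftrightarrow> finite ((\<lambda>(l, as). ftype as) ` F)"
  unfolding finite_up_to_order_and_associates_def same_factorization_rel_eq_kernel
  by (rule bij_betw_finite[OF bij_betw_image_quotient_kernel, symmetric])

section \<open>Factorizations of regular elements\<close>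

lemma regular_element_if_dvd:
  assumes "a \<in> regular_elements" and "x dvd a"
  shows "x \<in> regular_elements"
proof -
  obtain c where "a = x * c" using assms(2) ..
  then have "a * y = c * (x * y)" for y by (simp add: ac_simps)
  with assms(1) show ?thesis
    unfolding regular_elements_def by auto
qed

lemma factor_dvd:
  assumes "tau_factorization \<tau> a l as" and "x \<in> set as"
  shows "x dvd a"
proof -
  have "x dvd prod_list as"
    using dvd_prod_mset[of x "mset as"] assms(2) by (simp add: prod_mset_prod_list)
  then show ?thesis
    using assms(1) by (auto simp: tau_factorization_def intro: dvd_mult)
qed

lemma factor_regular_nonunit:
  assumes "a \<in> regular_nonunits" and "tau_factorization \<tau> a l as" and "x \<in> set as"
  shows "x \<in> regular_nonunits"
proof -
  have "x \<in> regular_elements"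
    using assms(1) factor_dvd[OF assms(2,3)] regular_element_if_dvd
    unfolding regular_nonunits_def by blast
  moreover have "\<not> x dvd 1"
    using assms(2,3) by (simp add: tau_factorization_def)
  ultimately show ?thesis by (simp add: regular_nonunits_def)
qed

lemma principal_ideal_factorization:
  "tau_factorization \<tau> a l as \<Longrightarrow> principal_ideal a = principal_ideal (prod_list as)"
  by (simp add: tau_factorization_def principal_ideal_unit_mult)

lemma tau_factorization_singleton: "\<not> a dvd 1 \<Longrightarrow> tau_factorization \<tau> a 1 [a]"
  by (simp add: tau_factorization_def)

text \<open>
  If one type is part of the other, then the factors matching the smaller type already multiply to
  an associate of \<open>a\<close>. Cancelling the regular element \<open>a\<close> shows that the product of the other
  factors is a unit. As factors are non-units, there are no other factors.
\<close>

lemma ftype_subset_imp_eq: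
  assumes a: "a \<in> regular_elements"
    and fact: "tau_factorization \<tau> a l as" "tau_factorization \<tau> a l' bs"
    and sub: "ftype as \<subseteq># ftype bs"
  shows "ftype as = ftype bs"
proof -
  obtain K where "ftype bs = ftype as + K"
    using sub by (auto simp: subset_mset.le_iff_add)
  then obtain B C where BC: "mset bs = B + C" "ftype as = image_mset principal_ideal B"
    by (blast dest: image_mset_eq_plusD)
  have "principal_ideal a = principal_ideal (prod_mset B)"
    using principal_ideal_prod_mset_cong[OF BC(2)] principal_ideal_factorization[OF fact(1)]
    by (simp add: prod_mset_prod_list)
  then obtain c where c: "prod_mset B = a * c"
    by (auto simp: principal_ideal_eq_iff)
  have "a = l' * prod_mset (mset bs)"
    using fact(2) by (simp add: tau_factorization_def prod_mset_prod_list)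
  also have "\<dots> = a * (l' * c * prod_mset C)"
    by (simp add: BC(1) c ac_simps)
  finally have "a * (1 - l' * c * prod_mset C) = 0"
    by (simp add: algebra_simps)
  then have "1 = prod_mset C * (l' * c)"
    using a by (auto simp: regular_elements_def ac_simps)
  then have "prod_mset C dvd 1" by (rule dvdI)
  then have "x dvd 1" if "x \<in># C" for x
    using dvd_prod_mset[OF that] dvd_trans by blast
  moreover have "\<not> x dvd 1" if "x \<in># C" for x
    using that fact(2) BC(1)
    by (metis set_mset_mset tau_factorization_def union_iff)
  ultimately have "C = {#}" by (meson multiset_nonemptyE)
  with BC show ?thesis by simp
qed

text \<open>
  No type in \<open>F\<close> is part of another one, and all types are multisets over the finite set of ideals
  generated by \<open>S\<close>, so Dickson's lemma applies. Taking for \<open>S\<close> all \<open>\<tau>\<close>-divisors or only the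
  irreducible ones covers both uses.
\<close>

lemma finite_types_if_finite_factors:
  assumes a: "a \<in> regular_elements"
    and F: "\<And>l as. (l, as) \<in> F \<Longrightarrow> tau_factorization \<tau> a l as \<and> set as \<subseteq> S"
    and S: "finite_up_to_associates S"
  shows "finite_up_to_order_and_associates F"
  unfolding finite_up_to_order_and_associates_iff
proof (rule finite_multiset_antichain)
  show "finite (principal_ideal ` S)"
    using S by (simp add: finite_up_to_associates_iff)
  show "set_mset M \<subseteq> principal_ideal ` S" if "M \<in> (\<lambda>(l, as). ftype as) ` F" for M
    using that F by fastforce
  show "M = N"
    if MN: "M \<in> (\<lambda>(l, as). ftype as) ` F" "N \<in> (\<lambda>(l, as). ftype as) ` F" "M \<subseteq># N" for M N
  proof -
    obtain l as l' bs where "(l, as) \<in> F" "M = ftype as" "(l', bs) \<in> F" "N = ftype bs"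
      using MN(1,2) by auto
    with F ftype_subset_imp_eq[OF a, of \<tau> l as l' bs] MN(3) show ?thesis by blast
  qed
qed

lemma tau_r_FFR_if_tau_r_WFFR:
  assumes "tau_r_WFFR \<tau>"
  shows "tau_r_FFR \<tau>"
  unfolding tau_r_FFR_def
proof
  fix a :: 'a assume a: "a \<in> regular_nonunits"
  show "finite_up_to_order_and_associates {(l, as). tau_factorization \<tau> a l as}"
  proof (rule finite_types_if_finite_factors[where \<tau> = \<tau> and S = "{b. tau_dvd \<tau> b a}"])
    show "a \<in> regular_elements" using a by (simp add: regular_nonunits_def)
    show "finite_up_to_associates {b. tau_dvd \<tau> b a}"
      using assms a by (simp add: tau_r_WFFR_def)
    show "tau_factorization \<tau> a l as \<and> set as \<subseteq> {b. tau_dvd \<tau> b a}"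
      if "(l, as) \<in> {(l, as). tau_factorization \<tau> a l as}" for l as
      using that unfolding tau_dvd_def by blast
  qed
qed

lemma tau_r_WFFR_if_tau_r_FFR:
  assumes "tau_r_FFR \<tau>"
  shows "tau_r_WFFR \<tau>"
  unfolding tau_r_WFFR_def finite_up_to_associates_iff
proof
  fix a :: 'a assume a: "a \<in> regular_nonunits"
  define types where "types = (\<lambda>(l, as). ftype as) ` {(l, as). tau_factorization \<tau> a l as}"
  have "finite types"
    using assms a by (simp add: tau_r_FFR_def finite_up_to_order_and_associates_iff types_def)
  then have "finite (\<Union>M\<in>types. set_mset M)" by simp
  moreover have "principal_ideal ` {b. tau_dvd \<tau> b a} \<subseteq> (\<Union>M\<in>types. set_mset M)"
  proof
    fix I assume "I \<in> principal_ideal ` {b. tau_dvd \<tau> b a}"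
    then obtain l as b where "tau_factorization \<tau> a l as" "b \<in> set as" "I = principal_ideal b"
      by (auto simp: tau_dvd_def)
    then have "ftype as \<in> types" and "I \<in> set_mset (ftype as)"
      unfolding types_def by (simp_all add: rev_image_eqI[where x = "(l, as)"])
    then show "I \<in> (\<Union>M\<in>types. set_mset M)" by blast
  qed
  ultimately show "finite (principal_ideal ` {b. tau_dvd \<tau> b a})"
    by (rule rev_finite_subset)
qed

lemma tau_r_idf_if_tau_r_WFFR:
  assumes "tau_r_WFFR \<tau>"
  shows "tau_r_idf \<tau>"
proof -
  have "finite (principal_ideal ` {b. tau_r_irreducible \<tau> b \<and> tau_dvd \<tau> b a})"
    if "a \<in> regular_nonunits" for a
  proof (rule finite_subset)
    show "finite (principal_ideal ` {b. tau_dvd \<tau> b a})"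
      using assms that by (simp add: tau_r_WFFR_def finite_up_to_associates_iff)
  qed (rule image_mono, simp add: Collect_mono_iff)
  then show ?thesis by (simp add: tau_r_idf_def finite_up_to_associates_iff)
qed

lemma finite_atomic_types_if_tau_r_idf:
  assumes "tau_r_idf \<tau>" and a: "a \<in> regular_nonunits"
  shows "finite_up_to_order_and_associates
    {(l, as). tau_factorization \<tau> a l as \<and> (\<forall>x\<in>set as. tau_r_irreducible \<tau> x)}"
proof (rule finite_types_if_finite_factors[where \<tau> = \<tau>
      and S = "{b. tau_r_irreducible \<tau> b \<and> tau_dvd \<tau> b a}"])
  show "a \<in> regular_elements" using a by (simp add: regular_nonunits_def)
  show "finite_up_to_associates {b. tau_r_irreducible \<tau> b \<and> tau_dvd \<tau> b a}"
    using assms by (simp add: tau_r_idf_def)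
  show "tau_factorization \<tau> a l as \<and> set as \<subseteq> {b. tau_r_irreducible \<tau> b \<and> tau_dvd \<tau> b a}"
    if "(l, as) \<in> {(l, as). tau_factorization \<tau> a l as \<and> (\<forall>x\<in>set as. tau_r_irreducible \<tau> x)}"
    for l as
    using that unfolding tau_dvd_def by blast
qed

section \<open>Refinement\<close>

text \<open>
  The refining factorization is chosen as a function of the factor instead of its position, so
  repeated factors are all refined in the same way.
\<close>

lemma tau_factorization_refine:
  assumes "refinable \<tau>" and fact: "tau_factorization \<tau> a l as"
    and "\<And>x. x \<in> set as \<Longrightarrow> tau_factorization \<tau> x (u x) (f x)"
  shows "tau_factorization \<tau> a (l * prod_list (map u as)) (concat (map f as))"
proof -
  have "tau_refinement \<tau> l as (l * prod_list (map u as)) (concat (map f as))"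
    unfolding tau_refinement_def
    by (rule exI[of _ "map u as"], rule exI[of _ "map f as"]) (use assms(3) in auto)
  with assms(1) fact show ?thesis unfolding refinable_def by blast
qed

text \<open>
  A factorization with one factor always contains an associate of the element. Hence a reducible
  element has a factorization with several factors, and refining with it increases the length.
\<close>

lemma longest_tau_factorization_atomic:
  assumes "refinable \<tau>" and a: "a \<in> regular_nonunits" and fact: "tau_factorization \<tau> a l as"
    and longest: "\<And>l' bs. tau_factorization \<tau> a l' bs \<Longrightarrow> length bs \<le> length as"
    and x: "x \<in> set as"
  shows "tau_r_irreducible \<tau> x"
proof (rule ccontr)
  assume "\<not> tau_r_irreducible \<tau> x"
  moreover have "x \<in> regular_nonunits" using factor_regular_nonunit[OF a fact x] .
  ultimately obtain k bs where bs: "tau_factorization \<tau> x k bs"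
    and no_assoc: "\<forall>y\<in>set bs. (x, y) \<notin> associate_rel"
    by (auto simp: tau_r_irreducible_def tau_r_factorization_def)
  have "length bs \<noteq> 1"
  proof
    assume "length bs = 1"
    then obtain y where y: "bs = [y]" by (auto simp: length_Suc_conv)
    then have "(x, y) \<in> associate_rel"
      using principal_ideal_factorization[OF bs] by (simp add: associate_rel_def)
    with no_assoc y show False by simp
  qed
  moreover have "bs \<noteq> []" using bs by (simp add: tau_factorization_def)
  ultimately have len: "length bs > 1" by (cases bs) auto
  \<comment> \<open>Every occurrence of \<open>x\<close> is replaced by \<open>bs\<close>, and the other factors are kept.\<close>
  let ?u = "\<lambda>y. if y = x then k else 1" and ?f = "\<lambda>y. if y = x then bs else [y]"
  have "tau_factorization \<tau> y (?u y) (?f y)" if "y \<in> set as" for y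
    using bs fact that by (auto intro: tau_factorization_singleton simp: tau_factorization_def)
  then have "tau_factorization \<tau> a (l * prod_list (map ?u as)) (concat (map ?f as))"
    by (rule tau_factorization_refine[OF assms(1) fact])
  then have "length (concat (map ?f as)) \<le> length as"
    by (rule longest)
  moreover have "length (concat (map ?f ys)) \<ge> length ys + (if x \<in> set ys then 1 else 0)" for ys
    using len by (induction ys) auto
  from this[of as] have "length (concat (map ?f as)) \<ge> length as + 1"
    using x by (simp only: if_True)
  ultimately show False by simp
qed

lemma tau_r_atomic_if_tau_r_FFR:
  assumes "refinable \<tau>" and "tau_r_FFR \<tau>"
  shows "tau_r_atomic \<tau>"
  unfolding tau_r_atomic_def
proof
  fix a :: 'a assume a: "a \<in> regular_nonunits"
  let ?F = "{(l, as). tau_factorization \<tau> a l as}"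
  have "finite (size ` (\<lambda>(l, as). ftype as) ` ?F)"
    using assms(2) a by (simp add: tau_r_FFR_def finite_up_to_order_and_associates_iff)
  then have fin: "finite ((\<lambda>(l, as). length as) ` ?F)"
    by (simp add: image_image case_prod_unfold)
  have "(1, [a]) \<in> ?F"
    using a by (simp add: regular_nonunits_def tau_factorization_singleton)
  then have "(\<lambda>(l, as). length as) ` ?F \<noteq> {}" by blast
  from Max_in[OF fin this] obtain l as where fact: "tau_factorization \<tau> a l as"
    and len: "length as = Max ((\<lambda>(l, as). length as) ` ?F)" by auto
  have "length bs \<le> length as" if "tau_factorization \<tau> a l' bs" for l' bs
    unfolding len using that by (intro Max_ge[OF fin]) force
  then have "\<forall>x\<in>set as. tau_r_irreducible \<tau> x"
    using longest_tau_factorization_atomic[OF assms(1) a fact] by blast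
  with a fact show "\<exists>l as. tau_r_factorization \<tau> a l as \<and> (\<forall>x\<in>set as. tau_r_irreducible \<tau> x)"
    by (auto simp: tau_r_factorization_def regular_nonunits_def)
qed

text \<open>
  Choose an atomic factorization \<open>f b\<close> for every regular non-unit \<open>b\<close>. A \<open>\<tau>\<close>-factorization of \<open>a\<close>
  with the factor \<open>b\<close> refines to an atomic one that contains \<open>f b\<close>. So \<open>f b\<close> has one of finitely
  many types, and its type determines the ideal of \<open>b\<close>.
\<close>

lemma tau_r_WFFR_if_finite_atomic_types:
  assumes "refinable \<tau>" and "tau_r_atomic \<tau>"
    and fin: "\<forall>a\<in>regular_nonunits. finite_up_to_order_and_associates
      {(l, as). tau_factorization \<tau> a l as \<and> (\<forall>x\<in>set as. tau_r_irreducible \<tau> x)}"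
  shows "tau_r_WFFR \<tau>"
  unfolding tau_r_WFFR_def finite_up_to_associates_iff
proof
  fix a :: 'a assume a: "a \<in> regular_nonunits"
  define types where "types = (\<lambda>(l, as). ftype as) `
    {(l, as). tau_factorization \<tau> a l as \<and> (\<forall>x\<in>set as. tau_r_irreducible \<tau> x)}"
  have finite_types: "finite types"
    using fin a by (simp add: finite_up_to_order_and_associates_iff types_def)
  have "\<forall>x\<in>regular_nonunits. \<exists>l as. tau_factorization \<tau> x l as \<and>
      (\<forall>y\<in>set as. tau_r_irreducible \<tau> y)"
    using assms(2) by (auto simp: tau_r_atomic_def tau_r_factorization_def)
  then obtain u f where uf: "\<And>x. x \<in> regular_nonunits \<Longrightarrow> tau_factorization \<tau> x (u x) (f x)"
    and atoms: "\<And>x y. x \<in> regular_nonunits \<Longrightarrow> y \<in> set (f x) \<Longrightarrow> tau_r_irreducible \<tau> y"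
    by metis
  have regular: "b \<in> regular_nonunits" if "tau_dvd \<tau> b a" for b
    using that factor_regular_nonunit[OF a] by (auto simp: tau_dvd_def)
  have "\<exists>M\<in>types. ftype (f b) \<subseteq># M" if b: "tau_dvd \<tau> b a" for b
  proof -
    obtain l as where fact: "tau_factorization \<tau> a l as" and b: "b \<in> set as"
      using b by (auto simp: tau_dvd_def)
    note factors = factor_regular_nonunit[OF a fact]
    have "tau_factorization \<tau> a (l * prod_list (map u as)) (concat (map f as))"
      using tau_factorization_refine[OF assms(1) fact] uf factors by blast
    moreover have "\<forall>y\<in>set (concat (map f as)). tau_r_irreducible \<tau> y"
      using atoms factors by auto
    ultimately have "ftype (concat (map f as)) \<in> types"
      unfolding types_def by force
    moreover have "mset (f b) \<subseteq># mset (concat (map f as))"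
      using split_list[OF b] by (auto simp: subset_mset.le_iff_add)
    then have "ftype (f b) \<subseteq># ftype (concat (map f as))"
      by (rule image_mset_subseteq_mono)
    ultimately show ?thesis by blast
  qed
  then have "(\<lambda>b. ftype (f b)) ` {b. tau_dvd \<tau> b a} \<subseteq> (\<Union>M\<in>types. {K. K \<subseteq># M})"
    by blast
  moreover have "finite (\<Union>M\<in>types. {K. K \<subseteq># M})"
    using finite_types by (simp add: finite_submultisets)
  ultimately have "finite ((\<lambda>b. ftype (f b)) ` {b. tau_dvd \<tau> b a})"
    by (rule finite_subset)
  then show "finite (principal_ideal ` {b. tau_dvd \<tau> b a})"
  proof (rule finite_image_if_factors)
    fix x y
    assume "x \<in> {b. tau_dvd \<tau> b a}" "y \<in> {b. tau_dvd \<tau> b a}" and "ftype (f x) = ftype (f y)"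
    then show "principal_ideal x = principal_ideal y"
      using principal_ideal_factorization[OF uf[OF regular]]
        principal_ideal_prod_mset_cong[of "mset (f x)" "mset (f y)"]
      by (simp add: prod_mset_prod_list)
  qed
qed

section \<open>The equivalences\<close>

text \<open>
  The conditions form the cycle FFR, atomic with idf, finitely many atomic factorizations, WFFR,
  FFR. The four conditions on regular divisors concern the same set as WFFR, since factors of
  regular elements are regular and their ideals contain the ideal of the product.
\<close>

theorem proposition3p2:
  fixes \<tau> :: "'a::comm_ring_1 rel"
  assumes "\<tau> \<subseteq> nonzero_nonunits \<times> nonzero_nonunits"
    and "sym \<tau>"
    and "refinable \<tau>"
  shows
    "(tau_r_FFR \<tau> \<longleftrightarrow> tau_r_WFFR \<tau>) \<and>
     (tau_r_FFR \<tau> \<longleftrightarrow> tau_r_atomic \<tau> \<and> tau_r_idf \<tau>) \<and>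
     (tau_r_FFR \<tau> \<longleftrightarrow> tau_r_atomic \<tau> \<and>
        (\<forall>a\<in>regular_nonunits. finite_up_to_order_and_associates
           {(l, as). tau_factorization \<tau> a l as \<and> (\<forall>x\<in>set as. tau_r_irreducible \<tau> x)})) \<and>
     (tau_r_FFR \<tau> \<longleftrightarrow>
        (\<forall>a\<in>regular_nonunits. finite_up_to_associates
           {b \<in> regular_nonunits. \<exists>l as. tau_r_factorization \<tau> a l as \<and> b \<in> set as})) \<and>
     (tau_r_FFR \<tau> \<longleftrightarrow>
        (\<forall>a\<in>regular_nonunits. finite
           {I. \<exists>b\<in>regular_nonunits. I = principal_ideal b \<and>
                (\<exists>l as. tau_r_factorization \<tau> a l as \<and> b \<in> set as) \<and>
                principal_ideal a \<subseteq> I})) \<and>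
     (tau_r_FFR \<tau> \<longleftrightarrow>
        (\<forall>a\<in>regular_nonunits. finite_up_to_associates {b \<in> regular_nonunits. tau_dvd \<tau> b a})) \<and>
     (tau_r_FFR \<tau> \<longleftrightarrow>
        (\<forall>a\<in>regular_nonunits. finite
           {I. \<exists>b\<in>regular_nonunits. I = principal_ideal b \<and> tau_dvd \<tau> b a \<and>
                principal_ideal a \<subseteq> I}))"
proof -
  have atomic_idf: "tau_r_FFR \<tau> \<Longrightarrow> tau_r_atomic \<tau> \<and> tau_r_idf \<tau>"
    using tau_r_atomic_if_tau_r_FFR[OF assms(3)] tau_r_WFFR_if_tau_r_FFR tau_r_idf_if_tau_r_WFFR
    by blast
  have WFFR: "tau_r_FFR \<tau> \<longleftrightarrow> tau_r_WFFR \<tau>"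
    using tau_r_FFR_if_tau_r_WFFR tau_r_WFFR_if_tau_r_FFR by blast
  note atomic_types = tau_r_WFFR_if_finite_atomic_types[OF assms(3)]
  have divisors: "{b \<in> regular_nonunits. tau_dvd \<tau> b a} = {b. tau_dvd \<tau> b a}"
    "{b \<in> regular_nonunits. \<exists>l as. tau_r_factorization \<tau> a l as \<and> b \<in> set as} = {b. tau_dvd \<tau> b a}"
    "{I. \<exists>b\<in>regular_nonunits. I = principal_ideal b \<and> tau_dvd \<tau> b a \<and> principal_ideal a \<subseteq> I} =
      principal_ideal ` {b. tau_dvd \<tau> b a}"
    "{I. \<exists>b\<in>regular_nonunits. I = principal_ideal b \<and>
        (\<exists>l as. tau_r_factorization \<tau> a l as \<and> b \<in> set as) \<and> principal_ideal a \<subseteq> I} =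
      principal_ideal ` {b. tau_dvd \<tau> b a}"
    if a: "a \<in> regular_nonunits" for a
  proof -
    have r: "(\<exists>l as. tau_r_factorization \<tau> a l as \<and> b \<in> set as) \<longleftrightarrow> tau_dvd \<tau> b a" for b
      using a by (simp add: tau_dvd_def tau_r_factorization_def regular_nonunits_def)
    have d: "b \<in> regular_nonunits" "principal_ideal a \<subseteq> principal_ideal b" if "tau_dvd \<tau> b a" for b
      using that factor_regular_nonunit[OF a] factor_dvd
      by (auto simp: tau_dvd_def principal_ideal_subset_iff)
    show "{b \<in> regular_nonunits. tau_dvd \<tau> b a} = {b. tau_dvd \<tau> b a}"
      "{b \<in> regular_nonunits. \<exists>l as. tau_r_factorization \<tau> a l as \<and> b \<in> set as} =
        {b. tau_dvd \<tau> b a}"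
      "{I. \<exists>b\<in>regular_nonunits. I = principal_ideal b \<and> tau_dvd \<tau> b a \<and> principal_ideal a \<subseteq> I} =
        principal_ideal ` {b. tau_dvd \<tau> b a}"
      "{I. \<exists>b\<in>regular_nonunits. I = principal_ideal b \<and>
          (\<exists>l as. tau_r_factorization \<tau> a l as \<and> b \<in> set as) \<and> principal_ideal a \<subseteq> I} =
        principal_ideal ` {b. tau_dvd \<tau> b a}"
      unfolding r using d by blast+
  qed
  show ?thesis
  proof (intro conjI)
    show "tau_r_FFR \<tau> \<longleftrightarrow> tau_r_WFFR \<tau>" by (rule WFFR)
    show "tau_r_FFR \<tau> \<longleftrightarrow> tau_r_atomic \<tau> \<and> tau_r_idf \<tau>"
      using atomic_idf WFFR atomic_types finite_atomic_types_if_tau_r_idf by blast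
    show "tau_r_FFR \<tau> \<longleftrightarrow> tau_r_atomic \<tau> \<and>
        (\<forall>a\<in>regular_nonunits. finite_up_to_order_and_associates
           {(l, as). tau_factorization \<tau> a l as \<and> (\<forall>x\<in>set as. tau_r_irreducible \<tau> x)})"
      using atomic_idf WFFR atomic_types finite_atomic_types_if_tau_r_idf by blast
  qed (unfold WFFR tau_r_WFFR_def finite_up_to_associates_iff,
      (rule ball_cong[OF refl], simp only: divisors)+)
qed

end
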